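(* A trihex has coinciding signatures if and only if it has a signature of the form $(tm-1,\ m-1,\ gm)$ for some integers $t\ge1$, $m\ge 1$, $0\le g<t$ with $g^2+g+1\equiv 0\pmod t$.
   Context: A trihex is a 3-regular graph embedded in the plane (equivalently the sphere) whose faces all have 3 or 6 sides, considered up to orientation-preserving homeomorphism. Every trihex arises as the quotient of the regular hexagonal tiling of the plane, positioned so the hexagons lie in vertical columns, by the group generated by $180^\circ$ rotations about the centers of a set of "special" hexagons whose centers form the vertices of a parallelogram lattice. Columns containing special hexagons are spine columns, the others are belt columns. The spine length $s\ge0$ is the number of hexagons strictly between two consecutive special hexagons in a spine column; $b\ge 0$ is the number of belt columns between two adjacent spine columns; the offset $f$ with $0\le f\le s$ is defined by: translating a special hexagon $b+1$ columns in the SW-to-NE direction lands it $f$ hexagons below a special hexagon. The triple $(s,b,f)$ is a signature of the trihex. Using instead columns of hexagons in the directions $60^\circ$ and $120^\circ$ clockwise from north gives two further signatures; these three signatures are the equivalent signatures of the trihex. If $(s_1,b_1,f_1)$ is one signature and $h=2s_1b_1+2s_1+2b_1$ (the number of hexagonal faces), the other two are given by: $s_2=j_2(b_1+1)-1$ where $j_2$ is the order of $f_1$ in $\mathbb{Z}_{s_1+1}$; $b_2=\frac{h-2s_2}{2s_2+2}$; $f_2\equiv -p_2(b_1+1)-(b_2+1)\pmod{s_2+1}$ where $p_2$ is the least positive integer with $p_2f_1\equiv b_2+1\pmod{s_1+1}$; $s_3=j_3(b_1+1)-1$ where $j_3$ is the order of $f_1+b_1+1$ in $\mathbb{Z}_{s_1+1}$;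 $b_3=\frac{h-2s_3}{2s_3+2}$; $f_3\equiv -p_3(b_1+1)\pmod{s_3+1}$ where $p_3$ is the least positive integer with $p_3(f_1+b_1+1)\equiv b_3+1\pmod{s_1+1}$ (each $f_i$ taken in $[0,s_i]$). A trihex has coinciding signatures if its three equivalent signatures are the same triple of numbers. *)

theory Defs
  imports "HOL-Analysis.Analysis" "HOL-Combinatorics.Orbits" "HOL-Number_Theory.Cong"
begin

text \<open>
  Connected graphs embedded in the oriented sphere, up to orientation-preserving homeomorphism,
  are encoded as combinatorial maps. A dart is an edge with a chosen direction; it belongs to the
  vertex it leaves and to the face on its left. \<open>opp\<close> reverses a dart, \<open>vrot\<close> gives the next dart
  counterclockwise around its vertex, \<open>fnext\<close> the next dart counterclockwise along the boundary of
  its face. Vertices, edges and faces are the orbits of \<open>vrot\<close>, \<open>opp\<close> and \<open>fnext\<close>.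
\<close>

record 'd cmap =
  darts :: "'d set"
  vrot :: "'d \<Rightarrow> 'd"
  opp :: "'d \<Rightarrow> 'd"
  fnext :: "'d \<Rightarrow> 'd"

definition cmap_iso :: "'d cmap \<Rightarrow> 'e cmap \<Rightarrow> bool" where
  "cmap_iso M N \<longleftrightarrow>
    (\<exists>h. bij_betw h (darts M) (darts N) \<and>
      (\<forall>x\<in>darts M. h (vrot M x) = vrot N (h x) \<and> h (opp M x) = opp N (h x) \<and>
        h (fnext M x) = fnext N (h x)))"

definition spherical_map :: "'d cmap \<Rightarrow> bool" where
  "spherical_map M \<longleftrightarrow>
    finite (darts M) \<and> darts M \<noteq> {} \<and>
    bij_betw (vrot M) (darts M) (darts M) \<and>
    bij_betw (opp M) (darts M) (darts M) \<and>
    bij_betw (fnext M) (darts M) (darts M) \<and>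
    (\<forall>x\<in>darts M. opp M x \<noteq> x \<and> opp M (opp M x) = x \<and> vrot M (fnext M x) = opp M x) \<and>
    (\<forall>x\<in>darts M. \<forall>y\<in>darts M.
      (x, y) \<in> ({(z, vrot M z) |z. z \<in> darts M} \<union> {(z, opp M z) |z. z \<in> darts M})\<^sup>*) \<and>
    int (card (orbit (vrot M) ` darts M)) - int (card (orbit (opp M) ` darts M))
      + int (card (orbit (fnext M) ` darts M)) = 2"

definition trihex :: "'d cmap \<Rightarrow> bool" where
  "trihex M \<longleftrightarrow> spherical_map M \<and>
    (\<forall>x\<in>darts M. card (orbit (vrot M) x) = 3) \<and>
    (\<forall>x\<in>darts M. card (orbit (fnext M) x) \<in> {3, 6})"

text \<open>
  The hexagonal tiling lies in the complex plane, with adjacent hexagons having centers at distance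
  1 and the hexagons arranged in vertical columns. The six directions to adjacent hexagons are
  numbered clockwise from north: N, NE, SE, S, SW, NW.
\<close>

definition hexdir :: "nat \<Rightarrow> complex" where
  "hexdir k = \<i> * cis (- (real k * pi / 3))"

definition hex_centers :: "complex set" where
  "hex_centers = {of_int a * hexdir 0 + of_int b * hexdir 1 |a b. True}"

text \<open>
  The dart \<open>(c, u)\<close> of the tiling is the side that the hexagon centered at \<open>c\<close> shares with the
  hexagon centered at \<open>c + u\<close>, directed counterclockwise around \<open>c\<close>.
\<close>

definition hex_darts :: "(complex \<times> complex) set" where
  "hex_darts = hex_centers \<times> hexdir ` {..<6}"

definition hex_opp :: "complex \<times> complex \<Rightarrow> complex \<times> complex" where
  "hex_opp = (\<lambda>(c, u). (c + u, - u))"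

definition hex_fnext :: "complex \<times> complex \<Rightarrow> complex \<times> complex" where
  "hex_fnext = (\<lambda>(c, u). (c, cis (pi / 3) * u))"

definition hex_vrot :: "complex \<times> complex \<Rightarrow> complex \<times> complex" where
  "hex_vrot = (\<lambda>(c, u). (c + cis (- (pi / 3)) * u, - cis (- (pi / 3)) * u))"

definition parallelogram_lattice :: "complex set \<Rightarrow> bool" where
  "parallelogram_lattice S \<longleftrightarrow>
    (\<exists>p v w. \<not> collinear {0, v, w} \<and> S = {p + of_int a * v + of_int b * w |a b. True})"

definition special_centers :: "complex set \<Rightarrow> bool" where
  "special_centers S \<longleftrightarrow> S \<subseteq> hex_centers \<and> parallelogram_lattice S"

definition half_turn :: "complex \<Rightarrow> complex \<times> complex \<Rightarrow> complex \<times> complex" where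
  "half_turn p = (\<lambda>(c, u). (2 * p - c, - u))"

text \<open>
  Half-turns are involutions, so the reflexive transitive closure below is the orbit relation of
  the group they generate.
\<close>

definition dart_class :: "complex set \<Rightarrow> complex \<times> complex \<Rightarrow> (complex \<times> complex) set" where
  "dart_class S x = {y. (x, y) \<in> {(z, half_turn p z) |z p. p \<in> S}\<^sup>*}"

text \<open>
  The half-turns commute with \<open>hex_vrot\<close>, \<open>hex_opp\<close> and \<open>hex_fnext\<close>, so these map classes to classes.
\<close>

definition hex_quotient :: "complex set \<Rightarrow> (complex \<times> complex) set cmap" where
  "hex_quotient S =
    \<lparr>darts = dart_class S ` hex_darts,
     vrot = (`) hex_vrot, opp = (`) hex_opp, fnext = (`) hex_fnext\<rparr>"

definition hex_column :: "nat \<Rightarrow> complex \<Rightarrow> complex set" where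
  "hex_column k c = {c + of_int n * hexdir k |n. True}"

definition spine_column :: "complex set \<Rightarrow> complex set \<Rightarrow> bool" where
  "spine_column S C \<longleftrightarrow> C \<inter> S \<noteq> {}"

text \<open>
  \<open>direction_signature S k (s, b, f)\<close>: the special hexagons \<open>S\<close> have signature \<open>(s, b, f)\<close> with
  respect to columns in direction \<open>hexdir k\<close>. This direction plays the role of north, hence
  \<open>hexdir (k + 1)\<close> that of the SW-to-NE direction.
\<close>

fun direction_signature :: "complex set \<Rightarrow> nat \<Rightarrow> nat \<times> nat \<times> nat \<Rightarrow> bool" where
  "direction_signature S k (s, b, f) \<longleftrightarrow>
    (\<forall>p\<in>S.
      p + of_nat (s + 1) * hexdir k \<in> S \<and>
      (\<forall>i\<in>{1..s}. p + of_nat i * hexdir k \<notin> S) \<and>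
      spine_column S (hex_column k (p + of_nat (b + 1) * hexdir (k + 1))) \<and>
      (\<forall>i\<in>{1..b}. \<not> spine_column S (hex_column k (p + of_nat i * hexdir (k + 1)))) \<and>
      f \<le> s \<and>
      p + of_nat (b + 1) * hexdir (k + 1) + of_nat f * hexdir k \<in> S)"

text \<open>
  The hexagonal tiling can be placed over a given trihex in several ways; they differ by
  translations and rotations of the tiling, which permute the three signatures. All placements are
  admitted, so this is the set consisting of the three equivalent signatures.
\<close>

definition signatures :: "'d cmap \<Rightarrow> (nat \<times> nat \<times> nat) set" where
  "signatures M =
    {\<sigma>. \<exists>S. special_centers S \<and> cmap_iso M (hex_quotient S) \<and>
      (\<exists>k\<in>{0, 1, 2}. direction_signature S k \<sigma>)}"

definition coinciding_signatures :: "'d cmap \<Rightarrow> bool" where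
  "coinciding_signatures M \<longleftrightarrow> is_singleton (signatures M)"

end

theory Submission imports Defs
begin

text \<open>
  Let \<open>L\<close> be the lattice of differences of special centers and \<open>\<omega>\<close> the clockwise rotation by
  60 degrees. A signature \<open>(s, b, f)\<close> in direction \<open>k\<close> says that \<open>L\<close> has basis \<open>(s + 1) h\<^sub>k\<close>,
  \<open>(b + 1) h\<^sub>k\<^sub>+\<^sub>1 + f h\<^sub>k\<close>, where \<open>h\<^sub>k = \<i> \<omega>\<^sup>k\<close>. So the signatures coincide iff \<open>\<omega> L = L\<close>, and
  expressing the rotated basis in the original one, using \<open>\<omega>\<^sup>2 = \<omega> - 1\<close>, this becomes
  \<open>(s + 1, b + 1, f) = (t m, m, g m)\<close> with \<open>t\<close> dividing \<open>g\<^sup>2 + g + 1\<close>. The signatures of a trihex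
  do not depend on the placement of the tiling, because an isomorphism between two quotients
  lifts to a rotation and translation matching the special centers.
\<close>

section \<open>The sixth root of unity \<omega> and coordinates on the hexagonal lattice\<close>

definition \<omega> :: complex where
  "\<omega> = cis (- (pi / 3))"

lemma omega_square: "\<omega> * \<omega> = \<omega> - 1"
proof -
  have "cos (2 * pi / 3) = - (1 / 2)" "sin (2 * pi / 3) = sqrt 3 / 2"
    by (simp_all add: cos_120 sin_120)
  then show ?thesis
    by (simp add: \<omega>_def cis_mult complex_eq_iff cos_60 sin_60)
qed

lemma omega_cube: "\<omega> ^ 3 = - 1"
proof -
  have "\<omega> ^ 3 = \<omega> * (\<omega> * \<omega>)" by (simp add: power3_eq_cube)
  also have "\<dots> = \<omega> * \<omega> - \<omega>" by (simp add: omega_square right_diff_distrib)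
  also have "\<dots> = - 1" by (simp add: omega_square)
  finally show ?thesis .
qed

lemma omega_power_6: "\<omega> ^ 6 = 1"
proof -
  have "\<omega> ^ 6 = (\<omega> ^ 3) ^ 2" by (simp flip: power_mult)
  then show ?thesis by (simp add: omega_cube)
qed

lemma omega_nonzero: "\<omega> \<noteq> 0"
  by (simp add: \<omega>_def)

text \<open>Exponents are natural numbers, so the rotation inverse to \<open>\<omega> ^ j\<close> is
  written with \<open>5 * j\<close>, which is \<open>- j\<close> modulo 6.\<close>

lemma omega_power_mult_inverse: "\<omega> ^ j * \<omega> ^ (5 * j) = 1"
proof -
  have "\<omega> ^ j * \<omega> ^ (5 * j) = (\<omega> ^ 6) ^ j" by (simp flip: power_mult power_add)
  then show ?thesis by (simp add: omega_power_6)
qed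

lemma cis_pi_third: "cis (pi / 3) = \<omega> ^ 5"
proof -
  have "cis (pi / 3) * \<omega> = 1" by (simp add: \<omega>_def cis_mult)
  moreover have "\<omega> ^ 5 * \<omega> = 1" using omega_power_6 by (simp add: eval_nat_numeral mult.commute)
  ultimately show ?thesis using omega_nonzero by (metis mult_right_cancel)
qed

lemma hexdir_eq: "hexdir k = \<i> * \<omega> ^ k"
  unfolding hexdir_def \<omega>_def Complex.DeMoivre by (simp only: mult_minus_right times_divide_eq_right)

text \<open>Coordinates adapted to columns along \<open>hexdir k\<close>: \<open>x\<close> counts
  along a column and \<open>y\<close> counts columns, so the conditions of a signature look the same
  for every \<open>k\<close>.\<close>

definition hex_point :: "nat \<Rightarrow> int \<Rightarrow> int \<Rightarrow> complex" where
  "hex_point k x y = of_int x * hexdir k + of_int y * hexdir (k + 1)"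

lemma hex_point_add: "hex_point k x y + hex_point k x' y' = hex_point k (x + x') (y + y')"
  by (simp add: hex_point_def algebra_simps)

lemma hex_point_diff: "hex_point k x y - hex_point k x' y' = hex_point k (x - x') (y - y')"
  by (simp add: hex_point_def algebra_simps)

lemma hex_point_scale: "of_int n * hex_point k x y = hex_point k (n * x) (n * y)"
  by (simp add: hex_point_def algebra_simps)

lemma omega_mult_hex_point: "\<omega> * hex_point k x y = hex_point (Suc k) x y"
  by (simp add: hex_point_def hexdir_eq algebra_simps)

text \<open>Since \<open>\<omega> * \<omega> = \<omega> - 1\<close>, direction \<open>k + 2\<close>
  is direction \<open>k + 1\<close> minus direction \<open>k\<close>. This change of basis is what
  relates signatures in consecutive directions.\<close>

lemma hex_point_Suc: "hex_point (Suc k) x y = hex_point k (- y) (x + y)"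
proof -
  have "\<omega> ^ Suc (Suc k) = \<omega> ^ k * (\<omega> * \<omega>)" by simp
  also have "\<dots> = \<omega> ^ Suc k - \<omega> ^ k" unfolding omega_square by (simp add: algebra_simps)
  finally have "hexdir (Suc k + 1) = hexdir (k + 1) - hexdir k"
    by (simp add: hexdir_eq right_diff_distrib)
  then show ?thesis
    unfolding hex_point_def by (simp only:) (simp add: algebra_simps)
qed

text \<open>Dividing by \<open>\<i> * \<omega> ^ k\<close> leaves \<open>x + y * \<omega>\<close>,
  and \<omega> is not real.\<close>

lemma hex_point_eq_zero: "hex_point k x y = 0 \<longleftrightarrow> x = 0 \<and> y = 0"
proof
  assume "hex_point k x y = 0"
  moreover have "hex_point k x y = \<i> * \<omega> ^ k * (of_int x + of_int y * \<omega>)"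
    by (simp add: hex_point_def hexdir_eq algebra_simps)
  ultimately have *: "of_int x + of_int y * \<omega> = 0" using omega_nonzero by simp
  from arg_cong[OF this, of Im] have "y = 0" by (simp add: \<omega>_def sin_60)
  with * show "x = 0 \<and> y = 0" by simp
qed (simp add: hex_point_def)

lemma hex_centers_iff: "z \<in> hex_centers \<longleftrightarrow> (\<exists>x y. z = hex_point k x y)"
proof (induction k)
  case 0
  then show ?case by (auto simp: hex_centers_def hex_point_def)
next
  case (Suc k)
  \<comment> \<open>The inverse change of basis is integral too, so both bases span the same
    lattice.\<close>
  have "hex_point k x y = hex_point (Suc k) (x + y) (- x)" for x y
    by (simp add: hex_point_Suc)
  with Suc show ?case by (metis hex_point_Suc)
qed

lemma hex_centers_add: "z \<in> hex_centers \<Longrightarrow> w \<in> hex_centers \<Longrightarrow> z + w \<in> hex_centers"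
  by (metis hex_centers_iff hex_point_add)

lemma hex_centers_diff: "z \<in> hex_centers \<Longrightarrow> w \<in> hex_centers \<Longrightarrow> z - w \<in> hex_centers"
  by (metis hex_centers_iff hex_point_diff)

lemma omega_mult_hex_centers: "z \<in> hex_centers \<Longrightarrow> \<omega> ^ j * z \<in> hex_centers"
proof (induction j)
  case (Suc j)
  then obtain x y where "\<omega> ^ j * z = hex_point 0 x y" using hex_centers_iff by blast
  then have "\<omega> ^ Suc j * z = hex_point (Suc 0) x y"
    by (simp add: mult.assoc flip: omega_mult_hex_point)
  then show ?case using hex_centers_iff by blast
qed simp

lemma hexdir_in_hex_centers: "hexdir k \<in> hex_centers"
proof -
  have "hexdir k = hex_point k 1 0" by (simp add: hex_point_def)
  then show ?thesis using hex_centers_iff by blast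
qed

text \<open>Connectedness of the tiling. The rule \<open>add\<close> covers backward steps as well,
  because the opposite of a direction is again some \<open>hexdir\<close>.\<close>

lemma hex_centers_induct [consumes 2, case_names base add]:
  assumes c: "c \<in> hex_centers" and c0: "c0 \<in> hex_centers" and base: "P c0"
    and add: "\<And>z k. z \<in> hex_centers \<Longrightarrow> P z \<Longrightarrow> P (z + hexdir k)"
  shows "P c"
proof -
  have neg: "- hexdir k = hexdir (k + 3)" for k
    by (simp add: hexdir_eq power_add omega_cube)
  have line: "P (z + of_int n * hexdir k) \<and> z + of_int n * hexdir k \<in> hex_centers"
    if "z \<in> hex_centers" "P z" for z n k
  proof (induction n rule: int_induct[where k = 0])
    case (step1 i)
    with add[of "z + of_int i * hexdir k" k]
      hex_centers_add[OF _ hexdir_in_hex_centers, of "z + of_int i * hexdir k" k]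
    show ?case by (simp add: algebra_simps)
  next
    case (step2 i)
    then have "P (z + of_int i * hexdir k + - hexdir k)"
      "z + of_int i * hexdir k + - hexdir k \<in> hex_centers"
      unfolding neg using add hex_centers_add[OF _ hexdir_in_hex_centers] by blast+
    then show ?case by (simp add: algebra_simps)
  qed (use that in simp)
  obtain a b where "c - c0 = of_int a * hexdir 0 + of_int b * hexdir 1"
    using hex_centers_diff[OF c c0] by (auto simp: hex_centers_def)
  then have "c = c0 + of_int a * hexdir 0 + of_int b * hexdir 1"
    by (simp add: algebra_simps)
  with line[of "c0 + of_int a * hexdir 0" b 1] line[OF c0 base, of a 0] show ?thesis by simp
qed

subsection \<open>Signatures of sublattices\<close>

locale hex_sublattice =
  fixes L :: "complex set"
  assumes zero_mem: "0 \<in> L"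
    and diff_mem: "z \<in> L \<Longrightarrow> w \<in> L \<Longrightarrow> z - w \<in> L"
    and subset_hex_centers: "L \<subseteq> hex_centers"
begin

lemma add_mem: "z \<in> L \<Longrightarrow> w \<in> L \<Longrightarrow> z + w \<in> L"
  using diff_mem[of z "0 - w"] diff_mem[OF zero_mem, of w] by simp

lemma scale_mem: "z \<in> L \<Longrightarrow> of_int n * z \<in> L"
proof (induction n rule: int_induct[where k = 0])
  case (step1 i)
  then show ?case using add_mem[of "of_int i * z" z] by (simp add: algebra_simps)
next
  case (step2 i)
  then show ?case using diff_mem[of "of_int i * z" z] by (simp add: algebra_simps)
qed (simp add: zero_mem)

end

text \<open>The conditions of \<open>direction_signature\<close> with the base point moved to 0. A
  belt column must avoid \<open>L\<close> at every height \<open>n\<close>; that column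
  \<open>b + 1\<close> is a spine is contained in the last conjunct.\<close>

fun lattice_signature :: "complex set \<Rightarrow> nat \<Rightarrow> nat \<times> nat \<times> nat \<Rightarrow> bool" where
  "lattice_signature L k (s, b, f) \<longleftrightarrow>
    hex_point k (int (s + 1)) 0 \<in> L \<and>
    (\<forall>i\<in>{1..s}. hex_point k (int i) 0 \<notin> L) \<and>
    (\<forall>i\<in>{1..b}. \<forall>n. hex_point k n (int i) \<notin> L) \<and>
    f \<le> s \<and>
    hex_point k (int f) (int (b + 1)) \<in> L"

text \<open>\<open>S\<close> is a coset of \<open>L\<close>, so the conditions read the same from
  every base point in \<open>S\<close>.\<close>

lemma direction_signature_iff_lattice_signature:
  assumes "S \<noteq> {}" and L: "\<And>p z. p \<in> S \<Longrightarrow> p + z \<in> S \<longleftrightarrow> z \<in> L"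
  shows "direction_signature S k \<sigma> \<longleftrightarrow> lattice_signature L k \<sigma>"
proof -
  obtain s b f where \<sigma>: "\<sigma> = (s, b, f)" by (cases \<sigma>)
  have 1: "p + of_nat i * hexdir k \<in> S \<longleftrightarrow> hex_point k (int i) 0 \<in> L" if "p \<in> S" for p i
    using L[OF that] by (simp add: hex_point_def)
  have 2: "p + of_nat i * hexdir (k + 1) + of_nat n * hexdir k \<in> S
      \<longleftrightarrow> hex_point k (int n) (int i) \<in> L" if "p \<in> S" for p i n
    using L[OF that, of "of_nat i * hexdir (k + 1) + of_nat n * hexdir k"]
    by (simp add: hex_point_def add_ac)
  have 3: "spine_column S (hex_column k (p + of_nat i * hexdir (k + 1)))
      \<longleftrightarrow> (\<exists>n. hex_point k n (int i) \<in> L)" if "p \<in> S" for p i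
  proof -
    have "spine_column S (hex_column k (p + of_nat i * hexdir (k + 1))) \<longleftrightarrow>
        (\<exists>n. p + (of_nat i * hexdir (k + 1) + of_int n * hexdir k) \<in> S)"
      by (auto simp: spine_column_def hex_column_def add.assoc)
    then show ?thesis unfolding L[OF that] by (simp add: hex_point_def add.commute)
  qed
  show ?thesis
    unfolding \<sigma> direction_signature.simps lattice_signature.simps
    using \<open>S \<noteq> {}\<close> by (simp only: 1 2 3 cong: ball_cong) blast
qed

context hex_sublattice
begin

text \<open>The vectors \<open>(s + 1, 0)\<close> and \<open>(f, b + 1)\<close> form a basis of
  \<open>L\<close> in Hermite normal form: the gaps required by the signature force the remainders
  of division to vanish.\<close>

lemma lattice_signature_mem_iff:
  assumes "lattice_signature L k (s, b, f)"
  shows "hex_point k x y \<in> L \<longleftrightarrow>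
    (\<exists>i j. x = i * int (s + 1) + j * int f \<and> y = j * int (b + 1))"
proof
  from assms have s: "hex_point k (int (s + 1)) 0 \<in> L"
    and f: "hex_point k (int f) (int (b + 1)) \<in> L" by simp_all
  have span: "hex_point k (i * int (s + 1) + j * int f) (j * int (b + 1)) \<in> L" for i j
    using add_mem[OF scale_mem[OF s, of i] scale_mem[OF f, of j]]
    unfolding hex_point_scale hex_point_add by simp
  show "hex_point k x y \<in> L" if "\<exists>i j. x = i * int (s + 1) + j * int f \<and> y = j * int (b + 1)"
    using that span by blast
  show "\<exists>i j. x = i * int (s + 1) + j * int f \<and> y = j * int (b + 1)" if xy: "hex_point k x y \<in> L"
  proof -
    \<comment> \<open>Subtracting \<open>j\<close> copies of the second vector leaves
      \<open>y mod (b + 1)\<close>; a positive remainder would put a point of \<open>L\<close> into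
      a belt column.\<close>
    define j where "j = y div int (b + 1)"
    have "hex_point k (x - j * int f) (y - j * int (b + 1)) \<in> L"
      using diff_mem[OF xy span[of 0 j]] unfolding hex_point_diff by simp
    then have "hex_point k (x - j * int f) (int (nat (y mod int (b + 1)))) \<in> L"
      by (simp add: j_def minus_div_mult_eq_mod)
    moreover have "y mod int (b + 1) < int (b + 1)" by (rule pos_mod_bound) simp
    then have "nat (y mod int (b + 1)) \<le> b" by linarith
    ultimately have "nat (y mod int (b + 1)) = 0"
      using assms unfolding lattice_signature.simps
      by (metis atLeastAtMost_iff less_one not_le)
    then have y: "y = j * int (b + 1)"
      using pos_mod_sign[of "int (b + 1)" y] div_mult_mod_eq[of y "int (b + 1)"]
      unfolding j_def by linarith
    \<comment> \<open>Now on the column through 0, where the gap of length \<open>s\<close> excludes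
      a positive remainder modulo \<open>s + 1\<close>.\<close>
    define i where "i = (x - j * int f) div int (s + 1)"
    let ?r = "(x - j * int f) mod int (s + 1)"
    have "hex_point k (x - j * int f - i * int (s + 1)) 0 \<in> L"
      using diff_mem[OF xy span[of i j]] unfolding hex_point_diff by (simp add: y algebra_simps)
    then have "hex_point k (int (nat ?r)) 0 \<in> L"
      by (simp add: i_def minus_div_mult_eq_mod)
    moreover have "?r < int (s + 1)" by (rule pos_mod_bound) simp
    then have "nat ?r \<le> s" by linarith
    ultimately have "nat ?r = 0"
      using assms unfolding lattice_signature.simps
      by (metis atLeastAtMost_iff less_one not_le)
    then have "x - j * int f = i * int (s + 1)"
      using pos_mod_sign[of "int (s + 1)" "x - j * int f"]
        div_mult_mod_eq[of "x - j * int f" "int (s + 1)"] unfolding i_def by linarith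
    then have "x = i * int (s + 1) + j * int f" by simp
    with y show ?thesis by blast
  qed
qed

text \<open>\<open>s\<close> and \<open>b\<close> are determined by minimality, and \<open>f\<close>
  modulo \<open>s + 1\<close>; the bound \<open>f \<le> s\<close> then selects the residue.\<close>

lemma lattice_signature_unique:
  assumes "lattice_signature L k \<sigma>" and "lattice_signature L k \<tau>"
  shows "\<sigma> = \<tau>"
proof -
  obtain s b f s' b' f' where eq: "\<sigma> = (s, b, f)" "\<tau> = (s', b', f')"
    by (cases \<sigma>; cases \<tau>)
  note sig = assms[unfolded eq]
  have s: "s = s'"
  proof (rule linorder_cases)
    show "s = s'" if "s < s'" using sig that by (auto dest: bspec[where x = "s + 1"])
    show "s = s'" if "s' < s" using sig that by (auto dest: bspec[where x = "s' + 1"])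
  qed
  have b: "b = b'"
  proof (rule linorder_cases)
    show "b = b'" if "b < b'" using sig that by (auto dest: bspec[where x = "b + 1"])
    show "b = b'" if "b' < b" using sig that by (auto dest: bspec[where x = "b' + 1"])
  qed
  have "hex_point k (int f - int f') 0 \<in> L"
    using sig diff_mem[of "hex_point k (int f) (int (b + 1))" "hex_point k (int f') (int (b + 1))"]
    by (simp add: b hex_point_diff)
  then have "int (s + 1) dvd int f - int f'"
    unfolding lattice_signature_mem_iff[OF sig(1)] by auto
  then have "int f = int f'"
    using sig by (intro cong_less_imp_eq_int[of _ "int (s + 1)"]) (auto simp: cong_iff_dvd_diff s)
  with s b show ?thesis by (simp add: eq)
qed

text \<open>The two multiples by \<open>N\<close> guarantee that the minima defining
  \<open>s\<close> and \<open>b\<close> exist.\<close>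

lemma lattice_signature_exists:
  assumes "N > 0" and x: "hex_point k (int N) 0 \<in> L" and y: "hex_point k 0 (int N) \<in> L"
  shows "\<exists>\<sigma>. lattice_signature L k \<sigma>"
proof -
  define s where "s = (LEAST s. hex_point k (int (s + 1)) 0 \<in> L)"
  define b where "b = (LEAST b. \<exists>n. hex_point k n (int (b + 1)) \<in> L)"
  have s1: "hex_point k (int (s + 1)) 0 \<in> L"
    unfolding s_def by (rule LeastI[where k = "N - 1"]) (use assms in simp)
  have s2: "hex_point k (int i) 0 \<notin> L" if "i \<in> {1..s}" for i
  proof -
    from that have "i - 1 < s" by auto
    from not_less_Least[OF this[unfolded s_def]] that show ?thesis by simp
  qed
  have "\<exists>n. hex_point k n (int (b + 1)) \<in> L"
    unfolding b_def by (rule LeastI[where k = "N - 1"]) (use assms in auto)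
  then obtain n where n: "hex_point k n (int (b + 1)) \<in> L" by blast
  have b2: "hex_point k n (int i) \<notin> L" if "i \<in> {1..b}" for i n
  proof -
    from that have "i - 1 < b" by auto
    from not_less_Least[OF this[unfolded b_def]] that show ?thesis by simp
  qed
  \<comment> \<open>Sliding the point at height \<open>n\<close> along its column by multiples of
    \<open>s + 1\<close> brings the offset into the range from 0 to \<open>s\<close>.\<close>
  define f where "f = nat (n mod int (s + 1))"
  have "int f = n mod int (s + 1)" by (simp add: f_def)
  then have f: "int f = n - n div int (s + 1) * int (s + 1)"
    by (simp only: minus_div_mult_eq_mod)
  have "hex_point k (int f) (int (b + 1)) \<in> L"
    using diff_mem[OF n scale_mem[OF s1, of "n div int (s + 1)"]]
    unfolding hex_point_scale hex_point_diff f by simp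
  moreover have "f \<le> s"
    using pos_mod_bound[of "int (s + 1)" n] unfolding f_def by linarith
  ultimately have "lattice_signature L k (s, b, f)" using s1 s2 b2 by simp
  then show ?thesis ..
qed

text \<open>The two vectors supplied by direction \<open>Suc k\<close> are integer combinations of
  those supplied by direction \<open>k\<close>; comparing coordinates gives the shape of the triple
  and the congruence.\<close>

lemma equal_signatures_form:
  assumes "lattice_signature L k (s, b, f)" and "lattice_signature L (Suc k) (s, b, f)"
  obtains t m g where "t \<ge> 1" "m \<ge> 1" "g < t" "[g\<^sup>2 + g + 1 = 0] (mod t)"
    "(s, b, f) = (t * m - 1, m - 1, g * m)"
proof -
  have "hex_point k 0 (int (s + 1)) \<in> L"
    and 2: "hex_point k (- int (b + 1)) (int f + int (b + 1)) \<in> L"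
    using assms(2) by (simp_all add: hex_point_Suc)
  then obtain i j where ij: "0 = i * int (s + 1) + j * int f" "int (s + 1) = j * int (b + 1)"
    unfolding lattice_signature_mem_iff[OF assms(1)] by blast
  define m where "m = b + 1"
  \<comment> \<open>By the second equation \<open>j\<close> is the quotient of \<open>s + 1\<close>
    by \<open>b + 1\<close>.\<close>
  define t where "t = nat j"
  have "j > 0" using ij(2) by (smt (verit) of_nat_0_le_iff mult_nonpos_nonneg of_nat_Suc Suc_eq_plus1)
  then have j: "j = int t" and "t \<ge> 1" by (simp_all add: t_def)
  have sm: "s + 1 = t * m" using ij(2) unfolding j m_def by (metis of_nat_eq_iff of_nat_mult)
  have "j * int f = - i * int (s + 1)" using ij(1) by simp
  then have "j * int f = j * (- i * int m)" unfolding sm j by simp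
  then have "int f = - i * int m" using \<open>j > 0\<close> by (metis less_irrefl mult_left_cancel)
  then have "int m dvd int f" by simp
  then have "m dvd f" by simp
  then obtain g where g: "f = g * m" by (metis dvd_def mult.commute)
  have "f < s + 1" using assms(1) by simp
  then have "g * m < t * m" unfolding g sm .
  then have "g < t" by simp
  \<comment> \<open>After cancelling \<open>m\<close>, the second coordinate gives
    \<open>j' = g + 1\<close> and the first becomes \<open>i' * t + (g + 1) * g = - 1\<close>, which
    is the congruence.\<close>
  from 2 obtain i' j' where ij': "- int m = i' * int (t * m) + j' * int (g * m)"
    "int (g * m) + int m = j' * int m"
    unfolding lattice_signature_mem_iff[OF assms(1)] sm g m_def[symmetric] by blast
  have m0: "int m \<noteq> 0" by (simp add: m_def)
  have "(int g + 1) * int m = j' * int m" using ij'(2) by (simp add: algebra_simps)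
  then have j': "j' = int g + 1" using m0 by simp
  have "(i' * int t + j' * int g) * int m = - 1 * int m" using ij'(1) by (simp add: algebra_simps)
  then have "i' * int t + j' * int g = - 1" using m0 by (metis mult_right_cancel)
  then have "int (g\<^sup>2 + g + 1) = int t * (- i')"
    by (simp add: j' power2_eq_square algebra_simps)
  then have "int t dvd int (g\<^sup>2 + g + 1)" by (rule dvdI)
  then have "t dvd g\<^sup>2 + g + 1" unfolding int_dvd_int_iff .
  then have "[g\<^sup>2 + g + 1 = 0] (mod t)" by (simp only: cong_0_iff)
  moreover have "(s, b, f) = (t * m - 1, m - 1, g * m)" "m \<ge> 1"
    using sm g by (simp_all add: m_def flip: sm)
  ultimately show ?thesis using that \<open>t \<ge> 1\<close> \<open>g < t\<close> by blast
qed

text \<open>Divisibility of \<open>g\<^sup>2 + g + 1\<close> by \<open>t\<close> is what makes the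
  coefficients of a rotated lattice vector integral.\<close>

lemma omega_invariant_if_signature_form:
  assumes sig: "lattice_signature L k (t * m - 1, m - 1, g * m)"
    and "t \<ge> 1" "m \<ge> 1" "[g\<^sup>2 + g + 1 = 0] (mod t)"
    and z: "z \<in> L"
  shows "\<omega> ^ i * z \<in> L"
proof -
  have tm: "int (t * m - 1 + 1) = int t * int m" "int (m - 1 + 1) = int m"
    using assms by simp_all
  have "t dvd g\<^sup>2 + g + 1" using assms by (simp add: cong_0_iff)
  then obtain q where "g\<^sup>2 + g + 1 = t * q" by (elim dvdE)
  then have q: "int g * int g + int g + 1 = int t * int q"
    unfolding power2_eq_square by (metis of_nat_1 of_nat_add of_nat_mult)
  have step: "\<omega> * z \<in> L" if z: "z \<in> L" for z
  proof -
    obtain x y where xy: "z = hex_point k x y" using z subset_hex_centers hex_centers_iff by blast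
    then obtain i j where i: "x = i * (int t * int m) + j * (int g * int m)" "y = j * int m"
      using z unfolding xy lattice_signature_mem_iff[OF sig] tm by auto
    \<comment> \<open>Coefficients of the rotated vector \<open>(- y, x + y)\<close>:
      \<open>j'\<close> is forced by the second coordinate, then \<open>i'\<close> by the first,
      where \<open>q\<close> replaces \<open>(g\<^sup>2 + g + 1) / t\<close>.\<close>
    define j' where "j' = i * int t + j * int g + j"
    define i' where "i' = - (i * int g + j * int q)"
    have "x + y = j' * int m" by (simp add: i j'_def algebra_simps)
    moreover have "- y = i' * (int t * int m) + j' * (int g * int m)"
    proof -
      have "i' * (int t * int m) + j' * (int g * int m)
          = j * int m * (int g * int g + int g - int t * int q)"
        by (simp add: i'_def j'_def algebra_simps)
      also have "\<dots> = - y" by (simp add: i flip: q)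
      finally show ?thesis ..
    qed
    ultimately have "hex_point k (- y) (x + y) \<in> L"
      unfolding lattice_signature_mem_iff[OF sig] tm by auto
    then show ?thesis by (simp add: xy omega_mult_hex_point hex_point_Suc)
  qed
  show ?thesis
    by (induction i) (use z step in \<open>auto simp: mult.assoc\<close>)
qed

text \<open>Passing to the next direction multiplies all points by \<omega>; the fifth power undoes
  this, so invariance transfers membership both ways.\<close>

lemma lattice_signature_Suc_iff:
  assumes inv: "\<And>z i. z \<in> L \<Longrightarrow> \<omega> ^ i * z \<in> L"
  shows "lattice_signature L (Suc k) \<sigma> \<longleftrightarrow> lattice_signature L k \<sigma>"
proof -
  have "hex_point (Suc k) x y \<in> L \<longleftrightarrow> hex_point k x y \<in> L" for x y
  proof -
    have "\<omega> ^ 5 * (\<omega> * hex_point k x y) = hex_point k x y"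
      using omega_power_6 by (simp add: eval_nat_numeral)
    then show ?thesis
      unfolding omega_mult_hex_point[symmetric] by (metis inv power_one_right)
  qed
  then show ?thesis by (cases \<sigma>) simp
qed

lemma lattice_signature_direction_irrelevant:
  assumes "\<And>z i. z \<in> L \<Longrightarrow> \<omega> ^ i * z \<in> L"
  shows "lattice_signature L k \<sigma> \<longleftrightarrow> lattice_signature L 0 \<sigma>"
  using lattice_signature_Suc_iff[OF assms] by (induction k) auto

end

section \<open>The difference lattice of a set of special centers\<close>

text \<open>\<open>L\<close> consists of the differences of special centers. It has rank 2 by
  non-collinearity, hence a signature in every direction.\<close>

lemma special_centers_lattice:
  assumes "special_centers S"
  obtains L where "hex_sublattice L" "S \<noteq> {}" "\<And>p z. p \<in> S \<Longrightarrow> p + z \<in> S \<longleftrightarrow> z \<in> L"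
    "\<And>k. \<exists>\<sigma>. lattice_signature L k \<sigma>"
proof -
  from assms obtain p v w where nc: "\<not> collinear {0, v, w}"
    and S: "S = {p + of_int a * v + of_int b * w |a b. True}" and sub: "S \<subseteq> hex_centers"
    unfolding special_centers_def parallelogram_lattice_def by blast
  define L where "L = {of_int a * v + of_int b * w |a b :: int. True}"
  have LI: "of_int a * v + of_int b * w \<in> L" for a b :: int by (auto simp: L_def)
  have SL: "z \<in> S \<longleftrightarrow> z - p \<in> L" for z
    unfolding S L_def by (auto simp: algebra_simps)
  have diff: "z - z' \<in> L" if zz: "z \<in> L" "z' \<in> L" for z z'
  proof -
    obtain a b a' b' :: int where "z = of_int a * v + of_int b * w" "z' = of_int a' * v + of_int b' * w"
      using zz by (auto simp: L_def)
    then have "z - z' = of_int (a - a') * v + of_int (b - b') * w" by (simp add: algebra_simps)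
    then show ?thesis using LI by (simp only:)
  qed
  have zero: "0 \<in> L" using LI[of 0 0] by simp
  have "p \<in> S" using SL zero by simp
  have "L \<subseteq> hex_centers"
  proof
    fix z assume "z \<in> L"
    then have "p + z \<in> hex_centers" "p \<in> hex_centers" using SL[of "p + z"] \<open>p \<in> S\<close> sub by auto
    from hex_centers_diff[OF this] show "z \<in> hex_centers" by simp
  qed
  then interpret hex_sublattice L using zero diff by unfold_locales
  have shift: "q + z \<in> S \<longleftrightarrow> z \<in> L" if "q \<in> S" for q z
    using that add_mem[of "q - p" z] diff_mem[of "q + z - p" "q - p"]
    by (auto simp: SL add_diff_eq algebra_simps)
  have "\<exists>\<sigma>. lattice_signature L k \<sigma>" for k
  proof -
    have "v \<in> L" "w \<in> L" using LI[of 1 0] LI[of 0 1] by simp_all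
    obtain v0 v1 w0 w1 where v: "v = hex_point k v0 v1" and w: "w = hex_point k w0 w1"
      using \<open>v \<in> L\<close> \<open>w \<in> L\<close> subset_hex_centers hex_centers_iff by (metis subsetD)
    \<comment> \<open>The determinant of \<open>v\<close> and \<open>w\<close>. By Cramer's rule
      \<open>L\<close> contains \<open>D\<close> times both basis vectors; the factor
      \<open>n\<close> below becomes \<open>sgn D\<close>, to reach the positive multiple.\<close>
    define D where "D = v0 * w1 - v1 * w0"
    have x: "hex_point k (n * D) 0 \<in> L" for n
      using scale_mem[OF diff_mem[OF scale_mem[OF \<open>v \<in> L\<close>, of w1] scale_mem[OF \<open>w \<in> L\<close>, of v1]], of n]
      by (simp add: v w hex_point_scale hex_point_diff D_def algebra_simps)
    have y: "hex_point k 0 (n * D) \<in> L" for n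
      using scale_mem[OF diff_mem[OF scale_mem[OF \<open>w \<in> L\<close>, of v0] scale_mem[OF \<open>v \<in> L\<close>, of w0]], of n]
      by (simp add: v w hex_point_scale hex_point_diff D_def algebra_simps)
    have "D \<noteq> 0"
    proof
      assume "D = 0"
      then have "of_int w0 * v = of_int v0 * w" "of_int w1 * v = of_int v1 * w"
        by (simp_all add: v w hex_point_scale D_def mult.commute)
      then have eq: "real_of_int w0 *\<^sub>R v = real_of_int v0 *\<^sub>R w"
        "real_of_int w1 *\<^sub>R v = real_of_int v1 *\<^sub>R w"
        by (simp_all add: scaleR_conv_of_real)
      have "w \<noteq> 0" "v \<noteq> 0" using nc by (auto simp: insert_commute)
      then have "w0 \<noteq> 0 \<or> w1 \<noteq> 0" unfolding w hex_point_eq_zero by blast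
      then obtain c where "v = c *\<^sub>R w"
        using eq by (metis of_int_eq_0_iff scaleR_scaleR left_inverse scaleR_one)
      then have "collinear {0, w, v}" using collinear_lemma by blast
      then show False using nc by (simp add: insert_commute)
    qed
    then show ?thesis
      using lattice_signature_exists[of "nat \<bar>D\<bar>" k] x[of "sgn D"] y[of "sgn D"]
      by (simp add: abs_sgn[symmetric] mult.commute del: lattice_signature.simps split_paired_Ex)
  qed
  with shift \<open>p \<in> S\<close> show ?thesis
    by (intro that[of L]) (auto intro: hex_sublattice_axioms)
qed

subsection \<open>Isomorphic quotients come from congruent sets of special hexagons\<close>

lemma half_turn_in_dart_class: "p \<in> S \<Longrightarrow> half_turn p z \<in> dart_class S z"
  unfolding dart_class_def by blast

text \<open>A bijection commuting with the half-turns maps orbits into orbits, and so does its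
  inverse.\<close>

lemma dart_class_image:
  assumes "bij F" and "\<And>p z. F (half_turn p z) = half_turn p (F z)"
  shows "F ` dart_class S x = dart_class S (F x)"
proof -
  let ?R = "{(z, half_turn p z) |z p. p \<in> S}"
  have fwd: "(G x, G y) \<in> ?R\<^sup>*"
    if "(x, y) \<in> ?R\<^sup>*" and G: "\<And>p z. G (half_turn p z) = half_turn p (G z)" for G x y
    using that(1)
  proof induction
    case (step y z)
    then have "(G y, G z) \<in> ?R" using G by blast
    with step show ?case by (meson rtrancl.rtrancl_into_rtrancl)
  qed simp
  have inv: "inv F (half_turn p z) = half_turn p (inv F z)" for p z
  proof -
    have "half_turn p z = F (half_turn p (inv F z))"
      using assms by (simp add: bij_is_surj surj_f_inv_f)
    then show ?thesis using bij_is_inj[OF assms(1)] by (simp add: inv_f_f)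
  qed
  show ?thesis
  proof (intro equalityI subsetI)
    fix y assume "y \<in> F ` dart_class S x"
    then show "y \<in> dart_class S (F x)" using fwd[of x _ F] assms(2) unfolding dart_class_def by blast
  next
    fix y assume "y \<in> dart_class S (F x)"
    then have "inv F y \<in> dart_class S x"
      using fwd[of "F x" y "inv F", OF _ inv] bij_is_inj[OF assms(1)]
      unfolding dart_class_def by (simp only: inv_f_f mem_Collect_eq)
    then show "y \<in> F ` dart_class S x"
      using bij_is_surj[OF assms(1)] by (intro image_eqI[where x = "inv F y"]) (simp_all add: surj_f_inv_f)
  qed
qed

lemma hex_fnext_eq: "hex_fnext (c, u) = (c, \<omega> ^ 5 * u)"
  by (simp add: hex_fnext_def cis_pi_third)

lemma hex_fnext_image_dart_class: "hex_fnext ` dart_class S x = dart_class S (hex_fnext x)"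
proof (rule dart_class_image)
  show "bij hex_fnext"
    by (rule o_bij[where g = "\<lambda>(c, u). (c, cis (- (pi / 3)) * u)"])
      (auto simp: hex_fnext_def fun_eq_iff cis_mult simp flip: mult.assoc)
qed (auto simp: hex_fnext_def half_turn_def)

lemma hex_opp_image_dart_class: "hex_opp ` dart_class S x = dart_class S (hex_opp x)"
proof (rule dart_class_image)
  show "bij hex_opp"
    by (rule o_bij[where g = hex_opp]) (auto simp: hex_opp_def fun_eq_iff)
qed (auto simp: hex_opp_def half_turn_def)

text \<open>Half-turns are involutions, so the reachability relation is symmetric.\<close>

lemma dart_class_eqI:
  assumes "y \<in> dart_class S x"
  shows "dart_class S y = dart_class S x"
proof -
  let ?R = "{(z, half_turn p z) |z p. p \<in> S}"
  have "sym ?R" by (rule symI) (force simp: half_turn_def)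
  then have "sym (?R\<^sup>*)" by (rule sym_rtrancl)
  with assms show ?thesis
    unfolding dart_class_def by (auto dest: symD intro: rtrancl_trans)
qed

text \<open>Products of evenly many half-turns are translations by \<open>2 * z\<close> with
  \<open>z\<close> in \<open>L\<close>; the others are half-turns about points of \<open>S\<close>.
  Only the latter reverse \<open>u\<close>, and such a half-turn fixes \<open>c\<close> only if
  \<open>c\<close> is its center.\<close>

lemma dart_class_uminus_iff:
  assumes L: "hex_sublattice L" "\<And>p z. p \<in> S \<Longrightarrow> p + z \<in> S \<longleftrightarrow> z \<in> L" and "u \<noteq> 0"
  shows "dart_class S (c, - u) = dart_class S (c, u) \<longleftrightarrow> c \<in> S"
proof
  assume "c \<in> S"
  then have "(c, - u) \<in> dart_class S (c, u)"
    using half_turn_in_dart_class[of c S "(c, u)"] by (simp add: half_turn_def)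
  then show "dart_class S (c, - u) = dart_class S (c, u)" by (rule dart_class_eqI)
next
  interpret hex_sublattice L by fact
  have sub: "p - q \<in> L" if "p \<in> S" "q \<in> S" for p q
    using L(2)[OF that(2), of "p - q"] that by simp
  \<comment> \<open>\<open>?C\<close> contains \<open>(c, u)\<close> and is closed under the
    half-turns, hence contains the orbit.\<close>
  let ?C = "{(c + 2 * z, u) |z. z \<in> L} \<union> {(2 * p - c, - u) |p. p \<in> S}"
  have "y \<in> ?C" if "(x, y) \<in> {(z, half_turn p z) |z p. p \<in> S}\<^sup>*" "x = (c, u)" for x y
    using that
  proof induction
    case base
    then show ?case using zero_mem by force
  next
    case (step y z)
    then obtain p where p: "p \<in> S" "z = half_turn p y" and y: "y \<in> ?C" by blast
    from y show ?case
    proof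
      assume "y \<in> {(c + 2 * z, u) |z. z \<in> L}"
      then obtain l where l: "l \<in> L" "y = (c + 2 * l, u)" by blast
      have "p + (0 - l) \<in> S" using L(2)[OF p(1)] diff_mem[OF zero_mem l(1)] by blast
      moreover have "z = (2 * (p + (0 - l)) - c, - u)"
        by (simp add: p l half_turn_def algebra_simps)
      ultimately show ?thesis by blast
    next
      assume "y \<in> {(2 * p - c, - u) |p. p \<in> S}"
      then obtain q where q: "q \<in> S" "y = (2 * q - c, - u)" by blast
      have "z = (c + 2 * (p - q), u)"
        by (simp add: p q half_turn_def algebra_simps)
      then show ?thesis using sub[OF p(1) q(1)] by blast
    qed
  qed
  then have C: "dart_class S (c, u) \<subseteq> ?C" unfolding dart_class_def by blast
  assume "dart_class S (c, - u) = dart_class S (c, u)"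
  moreover have "(c, - u) \<in> dart_class S (c, - u)" by (simp add: dart_class_def)
  ultimately have "(c, - u) \<in> ?C" using C by blast
  moreover have "- u \<noteq> u" using \<open>u \<noteq> 0\<close> by simp
  ultimately show "c \<in> S" by auto
qed

lemma hex_fnext_cubed: "hex_fnext (hex_fnext (hex_fnext (c, u))) = (c, - u)"
proof -
  have "\<omega> ^ 5 * (\<omega> ^ 5 * (\<omega> ^ 5 * u)) = (\<omega> ^ 3) ^ 5 * u"
    by (simp flip: mult.assoc power_add power_mult)
  then show ?thesis by (simp add: hex_fnext_eq omega_cube)
qed

text \<open>
  A special hexagon is recognised in the quotient by the fact that three steps along its boundary
  return to the starting dart; an isomorphism, lifted to the tiling by following darts, preserves
  this.
\<close>

lemma isomorphic_quotients_congruent: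
  fixes M :: "'d cmap"
  assumes M: "bij_betw (fnext M) (darts M) (darts M)" "bij_betw (opp M) (darts M) (darts M)"
    and S: "special_centers S" "cmap_iso M (hex_quotient S)" "p \<in> S"
    and S': "special_centers S'" "cmap_iso M (hex_quotient S')"
  obtains p' j where "p' \<in> S'"
    "\<And>z. z \<in> hex_centers \<Longrightarrow> p + z \<in> S \<longleftrightarrow> p' + \<omega> ^ j * z \<in> S'"
proof -
  from S obtain h where h: "bij_betw h (darts M) (dart_class S ` hex_darts)"
    and h_opp: "\<And>d. d \<in> darts M \<Longrightarrow> h (opp M d) = hex_opp ` h d"
    and h_fnext: "\<And>d. d \<in> darts M \<Longrightarrow> h (fnext M d) = hex_fnext ` h d"
    unfolding cmap_iso_def hex_quotient_def by auto
  from S' obtain h' where h': "bij_betw h' (darts M) (dart_class S' ` hex_darts)"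
    and h'_opp: "\<And>d. d \<in> darts M \<Longrightarrow> h' (opp M d) = hex_opp ` h' d"
    and h'_fnext: "\<And>d. d \<in> darts M \<Longrightarrow> h' (fnext M d) = hex_fnext ` h' d"
    unfolding cmap_iso_def hex_quotient_def by auto
  have p: "p \<in> hex_centers" using S unfolding special_centers_def by blast
  then have "(p, hexdir 0) \<in> hex_darts" by (simp add: hex_darts_def)
  then have "dart_class S (p, hexdir 0) \<in> h ` darts M" using h by (simp add: bij_betw_def)
  then obtain d0 where d0: "d0 \<in> darts M" "h d0 = dart_class S (p, hexdir 0)" by force
  then have "h' d0 \<in> dart_class S' ` hex_darts" using h' by (auto simp: bij_betw_def)
  \<comment> \<open>\<open>d0\<close> lies over \<open>p\<close> in the first quotient; its place in
    the second fixes the translation and rotation of the lift. That \<open>p'\<close> is special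
    comes only from \<open>key\<close>.\<close>
  then obtain p' j where j: "p' \<in> hex_centers" "h' d0 = dart_class S' (p', hexdir j)"
    by (auto simp: hex_darts_def)
  define \<phi> where "\<phi> = (\<lambda>c. p' + \<omega> ^ j * (c - p))"
  \<comment> \<open>The dart \<open>d\<close> of \<open>M\<close> lies below \<open>(c, u)\<close>
    in the first tiling and below its image under the rigid motion \<open>\<phi>\<close> in the
    second.\<close>
  define lifts where "lifts c u d \<longleftrightarrow> d \<in> darts M \<and>
    h d = dart_class S (c, u) \<and> h' d = dart_class S' (\<phi> c, \<omega> ^ j * u)" for c u d
  have base: "lifts p (hexdir 0) d0"
    using d0 j by (simp add: lifts_def \<phi>_def hexdir_eq mult.commute)
  have fnext: "lifts c (\<omega> ^ 5 * u) (fnext M d)" if "lifts c u d" for c u d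
    using that bij_betwE[OF M(1)] unfolding lifts_def
    by (simp add: h_fnext h'_fnext hex_fnext_image_dart_class hex_fnext_eq mult.left_commute)
  have opp: "lifts (c + u) (- u) (opp M d)" if "lifts c u d" for c u d
  proof -
    have "hex_opp (c, u) = (c + u, - u)"
      "hex_opp (\<phi> c, \<omega> ^ j * u) = (\<phi> (c + u), \<omega> ^ j * - u)"
      by (simp_all add: hex_opp_def \<phi>_def algebra_simps)
    then show ?thesis
      using that bij_betwE[OF M(2)] unfolding lifts_def
      by (simp add: h_opp h'_opp hex_opp_image_dart_class)
  qed
  have spin: "\<exists>d. lifts c (hexdir k) d" if d: "lifts c (hexdir i) d" for c i k d
  proof -
    have "\<exists>d. lifts c ((\<omega> ^ 5) ^ n * hexdir i) d" for n
      by (induction n) (use d fnext in \<open>auto simp: mult.assoc\<close>)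
    \<comment> \<open>Counterclockwise steps change the index by 5 modulo 6, and
      \<open>5 * (i + 5 * k) + i\<close> is congruent to \<open>k\<close>.\<close>
    then obtain d' where "lifts c ((\<omega> ^ 5) ^ (i + 5 * k) * hexdir i) d'" by blast
    moreover have "(\<omega> ^ 5) ^ (i + 5 * k) * hexdir i = hexdir k * (\<omega> ^ 6) ^ (i + 4 * k)"
      by (simp add: hexdir_eq algebra_simps flip: power_mult power_add)
    ultimately show ?thesis by (auto simp: omega_power_6)
  qed
  have all: "\<forall>k. \<exists>d. lifts c (hexdir k) d" if "c \<in> hex_centers" for c
    using that p
  proof (induction rule: hex_centers_induct)
    case base
    show ?case using \<open>lifts p (hexdir 0) d0\<close> spin by blast
  next
    case (add z k)
    then obtain d where "lifts z (hexdir k) d" by blast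
    from opp[OF this] have "lifts (z + hexdir k) (hexdir (k + 3)) (opp M d)"
      by (simp add: hexdir_eq power_add omega_cube)
    then show ?case using spin by blast
  qed
  have key: "c \<in> S \<longleftrightarrow> \<phi> c \<in> S'" if c: "c \<in> hex_centers" for c
  proof -
    obtain d where d: "lifts c (hexdir 0) d" using all[OF c] by blast
    define d3 where "d3 = fnext M (fnext M (fnext M d))"
    have "lifts c (\<omega> ^ 5 * (\<omega> ^ 5 * (\<omega> ^ 5 * hexdir 0))) d3"
      unfolding d3_def by (intro fnext d)
    moreover have "\<omega> ^ 5 * (\<omega> ^ 5 * (\<omega> ^ 5 * hexdir 0)) = - hexdir 0"
      using hex_fnext_cubed[of c "hexdir 0"] by (simp add: hex_fnext_eq)
    ultimately have d3: "lifts c (- hexdir 0) d3" by simp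
    have u: "hexdir 0 \<noteq> 0" "\<omega> ^ j * hexdir 0 \<noteq> 0" by (simp_all add: hexdir_eq omega_nonzero)
    obtain L where L: "hex_sublattice L" "\<And>p z. p \<in> S \<Longrightarrow> p + z \<in> S \<longleftrightarrow> z \<in> L"
      using special_centers_lattice[OF S(1)] by metis
    obtain L' where L': "hex_sublattice L'" "\<And>p z. p \<in> S' \<Longrightarrow> p + z \<in> S' \<longleftrightarrow> z \<in> L'"
      using special_centers_lattice[OF S'(1)] by metis
    have "c \<in> S \<longleftrightarrow> h d3 = h d"
      using d d3 dart_class_uminus_iff[OF L u(1)] by (simp add: lifts_def)
    \<comment> \<open>This condition is intrinsic to \<open>M\<close>, so it can be read in either
      quotient.\<close>
    also have "\<dots> \<longleftrightarrow> d3 = d"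
      using d d3 bij_betw_imp_inj_on[OF h] by (metis lifts_def inj_onD)
    also have "\<dots> \<longleftrightarrow> h' d3 = h' d"
      using d d3 bij_betw_imp_inj_on[OF h'] by (metis lifts_def inj_onD)
    also have "\<dots> \<longleftrightarrow> \<phi> c \<in> S'"
      using d d3 dart_class_uminus_iff[OF L' u(2)] by (simp add: lifts_def)
    finally show ?thesis .
  qed
  show ?thesis
  proof (rule that[of p' j])
    show "p' \<in> S'" using key[OF p] S by (simp add: \<phi>_def)
    show "p + z \<in> S \<longleftrightarrow> p' + \<omega> ^ j * z \<in> S'" if "z \<in> hex_centers" for z
      using key[OF hex_centers_add[OF p that]] by (simp add: \<phi>_def)
  qed
qed

section \<open>Coinciding signatures and the arithmetic form\<close>

theorem theorem4:
  fixes M :: "'d cmap"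
  assumes "trihex M"
  shows "coinciding_signatures M \<longleftrightarrow>
    (\<exists>t m g :: nat. t \<ge> 1 \<and> m \<ge> 1 \<and> g < t \<and> [g\<^sup>2 + g + 1 = 0] (mod t) \<and>
      (t * m - 1, m - 1, g * m) \<in> signatures M)"
proof
  assume "coinciding_signatures M"
  then obtain \<sigma> where \<sigma>: "signatures M = {\<sigma>}"
    unfolding coinciding_signatures_def by (elim is_singletonE)
  then obtain S where S: "special_centers S" "cmap_iso M (hex_quotient S)"
    unfolding signatures_def by blast
  obtain L where L: "hex_sublattice L" "S \<noteq> {}" "\<And>p z. p \<in> S \<Longrightarrow> p + z \<in> S \<longleftrightarrow> z \<in> L"
    and ex: "\<And>k. \<exists>\<sigma>. lattice_signature L k \<sigma>"
    using special_centers_lattice[OF S(1)] by metis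
  \<comment> \<open>The signature of this one placement in each direction belongs to a singleton
    set.\<close>
  have sig: "lattice_signature L k \<sigma>" if "k \<in> {0, 1, 2}" for k
  proof -
    obtain \<tau> where \<tau>: "lattice_signature L k \<tau>" using ex by blast
    then have "direction_signature S k \<tau>"
      using direction_signature_iff_lattice_signature[OF L(2,3)] by blast
    then have "\<tau> \<in> signatures M" using S that unfolding signatures_def by blast
    with \<sigma> \<tau> show ?thesis by simp
  qed
  obtain s b f where sbf: "\<sigma> = (s, b, f)" by (cases \<sigma>)
  obtain t m g where "t \<ge> 1" "m \<ge> 1" "g < t" "[g\<^sup>2 + g + 1 = 0] (mod t)"
    "(s, b, f) = (t * m - 1, m - 1, g * m)"
    using hex_sublattice.equal_signatures_form[OF L(1), of 0 s b f] sig[of 0] sig[of 1]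
    unfolding sbf by auto
  with \<sigma> sbf show "\<exists>t m g :: nat. t \<ge> 1 \<and> m \<ge> 1 \<and> g < t \<and> [g\<^sup>2 + g + 1 = 0] (mod t) \<and>
      (t * m - 1, m - 1, g * m) \<in> signatures M" by blast
next
  assume "\<exists>t m g :: nat. t \<ge> 1 \<and> m \<ge> 1 \<and> g < t \<and> [g\<^sup>2 + g + 1 = 0] (mod t) \<and>
      (t * m - 1, m - 1, g * m) \<in> signatures M"
  then obtain t m g :: nat where tmg: "t \<ge> 1" "m \<ge> 1" "[g\<^sup>2 + g + 1 = 0] (mod t)"
    and mem: "(t * m - 1, m - 1, g * m) \<in> signatures M" (is "?\<sigma> \<in> _") by blast
  then obtain S k where S: "special_centers S" "cmap_iso M (hex_quotient S)"
    and k: "direction_signature S k ?\<sigma>"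
    unfolding signatures_def by blast
  obtain L where L: "hex_sublattice L" "S \<noteq> {}" "\<And>p z. p \<in> S \<Longrightarrow> p + z \<in> S \<longleftrightarrow> z \<in> L"
    using special_centers_lattice[OF S(1)] by metis
  interpret hex_sublattice L by (rule L)
  have sig: "lattice_signature L k ?\<sigma>"
    using direction_signature_iff_lattice_signature[OF L(2,3)] k by blast
  note inv = omega_invariant_if_signature_form[OF sig tmg]
  obtain p where p: "p \<in> S" using L(2) by blast
  have M: "bij_betw (fnext M) (darts M) (darts M)" "bij_betw (opp M) (darts M) (darts M)"
    using assms unfolding trihex_def spherical_map_def by blast+
  have "\<tau> = ?\<sigma>" if "\<tau> \<in> signatures M" for \<tau>
  proof -
    from that obtain S' k' where S': "special_centers S'" "cmap_iso M (hex_quotient S')"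
      and k': "direction_signature S' k' \<tau>"
      unfolding signatures_def by blast
    obtain L' where L': "hex_sublattice L'" "S' \<noteq> {}" "\<And>p z. p \<in> S' \<Longrightarrow> p + z \<in> S' \<longleftrightarrow> z \<in> L'"
      using special_centers_lattice[OF S'(1)] by metis
    obtain p' j where p': "p' \<in> S'"
      and "\<And>z. z \<in> hex_centers \<Longrightarrow> p + z \<in> S \<longleftrightarrow> p' + \<omega> ^ j * z \<in> S'"
      using isomorphic_quotients_congruent[OF M S p S'] by metis
    then have iff: "z \<in> L \<longleftrightarrow> \<omega> ^ j * z \<in> L'" if "z \<in> hex_centers" for z
      using that L(3)[OF p] L'(3)[OF p'] by blast
    have unrotate: "\<omega> ^ j * (\<omega> ^ (5 * j) * z) = z" for z
      using omega_power_mult_inverse[of j] by (simp flip: mult.assoc)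
    \<comment> \<open>Any other placement has lattice \<open>\<omega> ^ j\<close> times
      \<open>L\<close>, which is \<open>L\<close> by invariance.\<close>
    have "L' = L"
    proof (intro equalityI subsetI)
      fix z assume z: "z \<in> L'"
      then have "z \<in> hex_centers" using hex_sublattice.subset_hex_centers[OF L'(1)] by blast
      from iff[OF omega_mult_hex_centers[OF this, of "5 * j"]] z
      have "\<omega> ^ (5 * j) * z \<in> L" by (simp add: unrotate)
      from inv[OF this, of j] show "z \<in> L" by (simp add: unrotate)
    next
      fix z assume "z \<in> L"
      from inv[OF this, of "5 * j"] have "\<omega> ^ (5 * j) * z \<in> L" .
      with iff[of "\<omega> ^ (5 * j) * z"] subset_hex_centers show "z \<in> L'" by (auto simp: unrotate)
    qed
    then have "lattice_signature L k' \<tau>"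
      using direction_signature_iff_lattice_signature[OF L'(2,3)] k' by blast
    \<comment> \<open>The directions \<open>k\<close> and \<open>k'\<close> may differ; invariance
      moves both signatures to direction 0, where uniqueness applies.\<close>
    with sig have "lattice_signature L 0 \<tau>" "lattice_signature L 0 ?\<sigma>"
      using lattice_signature_direction_irrelevant[OF inv] by blast+
    then show ?thesis by (rule lattice_signature_unique)
  qed
  with mem have "signatures M = {?\<sigma>}" by blast
  then show "coinciding_signatures M"
    unfolding coinciding_signatures_def by simp
qed

end
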